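(* Let $n$ be a natural number and let $0\leq a_1<\dots<a_k\leq n$ and $0\leq b_1<\dots<b_m\leq n$ be integers with $a_i\neq b_j$ for all $i,j$, such that \[\binom{n}{a_1}+\dots+\binom{n}{a_k}=\binom{n}{b_1}+\dots+\binom{n}{b_m}.\] Let $\mathcal{A}:=\{S\subseteq[n]\,:\,|S|\in\{a_1,\dots,a_k\}\}$ and $\mathcal{B}:=\{T\subseteq[n]\,:\,|T|\in\{b_1,\dots,b_m\}\}$. Then there exists a bijection $\Phi:\mathcal{A}\to\mathcal{B}$ such that for every $S\in\mathcal{A}$ we have either $S\subseteq\Phi(S)$ or $S\supseteq\Phi(S)$.
   Context: $[n]:=\{1,\dots,n\}$. An equality of the displayed form (with the stated conditions on the indices) is called a binomial identity, and the conclusion says the binomial identity is "orderable"; the theorem asserts all binomial identities are orderable. *)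

theory Defs
  imports Complex_Main
begin

end

theory Submission
  imports Defs
begin

text \<open>
  Any two levels of the Boolean lattice form a biregular comparability graph. Hence, if a family
  occupies a proportion \<open>p\<close> of level \<open>a\<close>, its neighbours occupy at least a proportion \<open>p\<close> of every
  level \<open>b\<close>. Averaging over the levels \<open>a\<^sub>i\<close> with weights \<open>n choose a\<^sub>i\<close>, a subfamily of the
  \<open>\<A>\<close>-side of relative size \<open>p\<close> has neighbours of relative size at least \<open>p\<close> in each level \<open>b\<^sub>j\<close>,
  so in the whole \<open>\<B>\<close>-side. As both sides have the same size, this is Hall's condition.
\<close>

text \<open>Halmos-Vaughan induction on \<open>I\<close>. If some nonempty proper \<open>J\<close>
  is tight, \<open>J\<close> and \<open>I - J\<close> are matched separately. If none is, every
  nonempty proper subfamily has a surplus neighbour, so one index may be matched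
  arbitrarily.\<close>

theorem hall_marriage:
  assumes "finite I" and "\<And>i. i \<in> I \<Longrightarrow> finite (N i)"
    and "\<And>J. J \<subseteq> I \<Longrightarrow> card J \<le> card (\<Union> (N ` J))"
  shows "\<exists>f. inj_on f I \<and> (\<forall>i\<in>I. f i \<in> N i)"
  using assms
proof (induction I arbitrary: N rule: finite_psubset_induct)
  case (psubset I)
  note fin = psubset.prems(1) and hall = psubset.prems(2)
  have finU: "finite (\<Union> (N ` J))" if "J \<subseteq> I" for J
    using that fin finite_subset[OF that psubset.hyps] by auto
  consider "I = {}" | J where "J \<noteq> {}" "J \<subset> I" "card (\<Union> (N ` J)) = card J"
    | "I \<noteq> {}" "\<And>J. J \<noteq> {} \<Longrightarrow> J \<subset> I \<Longrightarrow> card (\<Union> (N ` J)) \<noteq> card J"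
    by metis
  then show ?case
  proof cases
    case 1
    then show ?thesis by simp
  next
    case (2 J)
    have "\<exists>f. inj_on f J \<and> (\<forall>i\<in>J. f i \<in> N i)"
    proof (rule psubset.IH[OF \<open>J \<subset> I\<close>])
      show "finite (N i)" if "i \<in> J" for i
        using that 2 fin by blast
      show "card K \<le> card (\<Union> (N ` K))" if "K \<subseteq> J" for K
        using that 2 hall[of K] by blast
    qed
    then obtain f where f: "inj_on f J" "\<And>i. i \<in> J \<Longrightarrow> f i \<in> N i" by blast
    \<comment> \<open>Hall's condition survives outside \<open>J\<close>: the family
      \<open>K \<union> J\<close> has at least \<open>card K + card J\<close> neighbours, and
      tightness says that only \<open>card J\<close> of them are deleted.\<close>
    let ?N = "\<lambda>i. N i - \<Union> (N ` J)"
    have "\<exists>g. inj_on g (I - J) \<and> (\<forall>i\<in>I - J. g i \<in> ?N i)"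
    proof (rule psubset.IH)
      show "I - J \<subset> I" using 2 by blast
      show "finite (?N i)" if "i \<in> I - J" for i
        using that fin by blast
      show "card K \<le> card (\<Union> (?N ` K))" if K: "K \<subseteq> I - J" for K
      proof -
        have KJ: "K \<union> J \<subseteq> I" using K 2 by blast
        have "card K + card J = card (K \<union> J)"
          using K KJ finite_subset[OF KJ psubset.hyps] by (subst card_Un_disjoint) auto
        also have "\<dots> \<le> card (\<Union> (N ` (K \<union> J)))"
          using hall[OF KJ] .
        also have "\<Union> (N ` (K \<union> J)) = \<Union> (?N ` K) \<union> \<Union> (N ` J)" by blast
        also have "card \<dots> \<le> card (\<Union> (?N ` K)) + card J"
          using card_Un_le 2 by metis
        finally show ?thesis by simp
      qed
    qed
    then obtain g where g: "inj_on g (I - J)" "\<And>i. i \<in> I - J \<Longrightarrow> g i \<in> ?N i" by blast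
    let ?h = "\<lambda>i. if i \<in> J then f i else g i"
    have "inj_on ?h I"
    proof (rule inj_onI)
      fix i j assume ij: "i \<in> I" "j \<in> I" "?h i = ?h j"
      have "i \<in> J \<longleftrightarrow> j \<in> J"
        using ij f(2) g(2) by (smt (verit) DiffD2 DiffI UN_I)
      then show "i = j"
        using ij f(1) g(1) by (auto dest: inj_onD split: if_splits)
    qed
    moreover have "\<forall>i\<in>I. ?h i \<in> N i" using f(2) g(2) by auto
    ultimately show ?thesis by blast
  next
    case 3
    then obtain i where i: "i \<in> I" by blast
    have "card {i} \<le> card (N i)" using hall[of "{i}"] i by simp
    then obtain x where x: "x \<in> N i" by fastforce
    let ?N = "\<lambda>j. N j - {x}"
    have "\<exists>g. inj_on g (I - {i}) \<and> (\<forall>j\<in>I - {i}. g j \<in> ?N j)"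
    proof (rule psubset.IH)
      show "I - {i} \<subset> I" using i by blast
      show "finite (?N j)" if "j \<in> I - {i}" for j
        using that fin by blast
      show "card K \<le> card (\<Union> (?N ` K))" if K: "K \<subseteq> I - {i}" for K
      proof (cases "K = {}")
        case False
        have "K \<subset> I" using K i by blast
        \<comment> \<open>The strict surplus pays for the loss of \<open>x\<close>, the only element
          deleted from the neighbourhood.\<close>
        then have "card K < card (\<Union> (N ` K))"
          using 3(2)[OF False] hall[of K] by fastforce
        moreover have "\<Union> (?N ` K) = \<Union> (N ` K) - {x}" by blast
        moreover have "card (\<Union> (N ` K)) - 1 \<le> card (\<Union> (N ` K) - {x})"
          by (simp add: card_Diff_singleton_if)
        ultimately show ?thesis by simp
      qed simp
    qed
    then obtain g where g: "inj_on g (I - {i})" "\<And>j. j \<in> I - {i} \<Longrightarrow> g j \<in> ?N j" by blast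
    have "inj_on (g(i := x)) I"
      using g by (fastforce simp: inj_on_def)
    moreover have "\<forall>j\<in>I. (g(i := x)) j \<in> N j" using g x by auto
    ultimately show ?thesis by blast
  qed
qed

text \<open>Double counting of the edges leaving \<open>F\<close>: each element of \<open>F\<close>
  emits \<open>d\<close>, each neighbour absorbs at most \<open>e\<close>, and
  \<open>card X * d = card Y * e\<close> converts degrees into sizes. The comparison of proportions
  is cross-multiplied to stay in the naturals.\<close>

lemma biregular_normalized_matching:
  assumes "finite X" "finite Y"
    and dX: "\<And>x. x \<in> X \<Longrightarrow> card {y\<in>Y. R x y} = d"
    and dY: "\<And>y. y \<in> Y \<Longrightarrow> card {x\<in>X. R x y} = e"
    and "d > 0" and "F \<subseteq> X"
  shows "card F * card Y \<le> card {y\<in>Y. \<exists>x\<in>F. R x y} * card X"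
proof -
  let ?G = "{y\<in>Y. \<exists>x\<in>F. R x y}"
  have finF: "finite F" using assms finite_subset by blast
  have total: "card X * d = card Y * e"
    using sum_multicount_gen[of X Y R "\<lambda>_. e"] assms by simp
  have "card F * d = (\<Sum>x\<in>F. card {y\<in>?G. R x y})"
  proof -
    have "{y\<in>?G. R x y} = {y\<in>Y. R x y}" if "x \<in> F" for x using that by blast
    then show ?thesis using dX \<open>F \<subseteq> X\<close> by (simp add: subset_iff)
  qed
  also have "\<dots> = (\<Sum>y\<in>?G. card {x\<in>F. R x y})"
    using sum_multicount_gen[of F ?G R "\<lambda>y. card {x\<in>F. R x y}"] finF assms by simp
  also have "\<dots> \<le> (\<Sum>y\<in>?G. e)"
  proof (rule sum_mono)
    fix y assume "y \<in> ?G"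
    then show "card {x\<in>F. R x y} \<le> e"
      using dY[of y] card_mono[of "{x\<in>X. R x y}" "{x\<in>F. R x y}"] assms by auto
  qed
  finally have local: "card F * d \<le> card ?G * e" by simp
  show ?thesis
  \<comment> \<open>The factor \<open>e\<close> is cancelled at the end. If it vanishes,
    \<open>local\<close> and \<open>d > 0\<close> force \<open>card F = 0\<close>.\<close>
  proof (cases "e = 0")
    case True
    then show ?thesis using local \<open>d > 0\<close> by simp
  next
    case False
    have "card F * card Y * e = card F * d * card X"
      using total by (metis mult.assoc mult.commute)
    also have "\<dots> \<le> card ?G * e * card X"
      using local by (rule mult_le_mono1)
    finally have "(card F * card Y) * e \<le> (card ?G * card X) * e"
      by (simp add: ac_simps)
    then show ?thesis using False by simp
  qed
qed

text \<open>Deleting \<open>S\<close> is a bijection onto the subsets of \<open>U - S\<close> of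
  size \<open>b - card S\<close>, with inverse \<open>T \<union> S\<close>.\<close>

lemma card_supersets_of_card:
  assumes "finite U" "S \<subseteq> U" "card S \<le> b"
  shows "card {T. T \<subseteq> U \<and> card T = b \<and> S \<subseteq> T} = (card U - card S) choose (b - card S)"
proof -
  have finS: "finite S" using assms finite_subset by blast
  have "bij_betw (\<lambda>T. T - S) {T. T \<subseteq> U \<and> card T = b \<and> S \<subseteq> T}
      {T. T \<subseteq> U - S \<and> card T = b - card S}"
  proof (rule bij_betw_byWitness[where f' = "\<lambda>T. T \<union> S"])
    show "(\<lambda>T. T \<union> S) ` {T. T \<subseteq> U - S \<and> card T = b - card S}
        \<subseteq> {T. T \<subseteq> U \<and> card T = b \<and> S \<subseteq> T}"
    proof clarify
      fix T assume T: "T \<subseteq> U - S" "card T = b - card S"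
      then have "finite T" "T \<inter> S = {}"
        using assms(1) finite_subset by blast+
      then show "T \<union> S \<subseteq> U \<and> card (T \<union> S) = b \<and> S \<subseteq> T \<union> S"
        using T assms finS by (auto simp: card_Un_disjoint)
    qed
  qed (use finS in \<open>auto simp: card_Diff_subset\<close>)
  then have "card {T. T \<subseteq> U \<and> card T = b \<and> S \<subseteq> T} = card (U - S) choose (b - card S)"
    using n_subsets[of "U - S"] assms(1) by (simp add: bij_betw_same_card)
  then show ?thesis
    using assms finS by (simp add: card_Diff_subset)
qed

lemma levels_normalized_matching:
  assumes U: "finite U" and ab: "a \<le> card U" "b \<le> card U"
    and F: "F \<subseteq> {S. S \<subseteq> U \<and> card S = a}"
  shows "card F * (card U choose b)
    \<le> card {T. T \<subseteq> U \<and> card T = b \<and> (\<exists>S\<in>F. S \<subseteq> T \<or> T \<subseteq> S)} * (card U choose a)"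
proof -
  let ?L = "\<lambda>c. {S. S \<subseteq> U \<and> card S = c}"
  have finL: "finite (?L c)" for c using U by simp
  have cardL: "card (?L c) = card U choose c" for c using U by (rule n_subsets)
  have up: "card {T \<in> ?L d. S \<subseteq> T} = (card U - c) choose (d - c)"
    if "S \<in> ?L c" "c \<le> d" for S c d
    using that card_supersets_of_card[OF U, of S d] by (simp add: conj_assoc)
  have down: "card {S \<in> ?L c. S \<subseteq> T} = d choose c" if "T \<in> ?L d" for T c d
  proof -
    have "{S \<in> ?L c. S \<subseteq> T} = {S. S \<subseteq> T \<and> card S = c}" using that by auto
    moreover have "finite T" using that U finite_subset by blast
    ultimately show ?thesis using that n_subsets[of T c] by simp
  qed
  \<comment> \<open>\<open>R\<close> is inclusion in whichever direction the order of
    \<open>a\<close> and \<open>b\<close> permits. The degrees come from \<open>up\<close> and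
    \<open>down\<close>; the one seen from level \<open>a\<close> is positive because
    \<open>b \<le> card U\<close> in the first case and \<open>b \<le> a\<close> in the
    second.\<close>
  have "\<exists>R. card F * card (?L b) \<le> card {T \<in> ?L b. \<exists>S\<in>F. R S T} * card (?L a)
      \<and> (\<forall>S T. R S T \<longrightarrow> S \<subseteq> T \<or> T \<subseteq> S)"
  proof (cases "a \<le> b")
    case True
    have "card F * card (?L b) \<le> card {T \<in> ?L b. \<exists>S\<in>F. S \<subseteq> T} * card (?L a)"
      using True ab
      by (intro biregular_normalized_matching[OF finL finL up[where c = a] down[where d = b] _ F])
        (simp_all only: zero_less_binomial_iff diff_le_mono)
    then show ?thesis by (intro exI[of _ "(\<subseteq>)"]) simp
  next
    case False
    have "card F * card (?L b) \<le> card {T \<in> ?L b. \<exists>S\<in>F. T \<subseteq> S} * card (?L a)"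
      using False ab
      by (intro biregular_normalized_matching[OF finL finL down[where d = a] up[where c = b] _ F])
        (simp_all only: zero_less_binomial_iff nat_le_linear)
    then show ?thesis by (intro exI[of _ "\<lambda>S T. T \<subseteq> S"]) simp
  qed
  then obtain R where R: "card F * card (?L b) \<le> card {T \<in> ?L b. \<exists>S\<in>F. R S T} * card (?L a)"
    "\<And>S T. R S T \<Longrightarrow> S \<subseteq> T \<or> T \<subseteq> S" by blast
  have "card {T \<in> ?L b. \<exists>S\<in>F. R S T}
      \<le> card {T. T \<subseteq> U \<and> card T = b \<and> (\<exists>S\<in>F. S \<subseteq> T \<or> T \<subseteq> S)}"
    using R(2) U by (intro card_mono) auto
  then show ?thesis
    using R(1) unfolding cardL by (meson le_trans mult_le_mono1)
qed

lemma card_eq_sum_levels: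
  assumes "finite U" "finite A" "F \<subseteq> {S. S \<subseteq> U \<and> card S \<in> A}"
  shows "card F = (\<Sum>a\<in>A. card {S\<in>F. card S = a})"
proof -
  have "finite F" using assms(1,3) by (auto intro: finite_subset[of _ "Pow U"])
  moreover have "card ` F \<subseteq> A" using assms(3) by blast
  ultimately show ?thesis
    using sum.group[of F A card "\<lambda>_. 1::nat"] assms(2) by simp
qed

text \<open>Hall's theorem gives an injection along comparable pairs, and equality of the two
  binomial sums makes it onto. Working with sets of levels rather than sequences keeps indices out
  of the argument.\<close>

theorem binomial_identity_orderable:
  assumes U: "finite U" and A: "A \<subseteq> {..card U}" and B: "B \<subseteq> {..card U}"
    and eq: "(\<Sum>a\<in>A. card U choose a) = (\<Sum>b\<in>B. card U choose b)"
  shows "\<exists>\<Phi>. bij_betw \<Phi> {S. S \<subseteq> U \<and> card S \<in> A} {T. T \<subseteq> U \<and> card T \<in> B}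
    \<and> (\<forall>S\<in>{S. S \<subseteq> U \<and> card S \<in> A}. S \<subseteq> \<Phi> S \<or> \<Phi> S \<subseteq> S)"
proof -
  let ?L = "\<lambda>A. {S. S \<subseteq> U \<and> card S \<in> A}"
  let ?M = "\<Sum>a\<in>A. card U choose a"
  let ?N = "\<lambda>S. {T \<in> ?L B. S \<subseteq> T \<or> T \<subseteq> S}"
  have fin: "finite A" "finite B" using A B finite_subset by blast+
  have finL: "finite (?L C)" for C using U by simp
  have cardL: "card (?L C) = (\<Sum>c\<in>C. card U choose c)" if "finite C" for C
  proof -
    have "card (?L C) = (\<Sum>c\<in>C. card {S \<in> ?L C. card S = c})"
      using card_eq_sum_levels[OF U that, of "?L C"] by simp
    also have "\<dots> = (\<Sum>c\<in>C. card {S. S \<subseteq> U \<and> card S = c})"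
      by (intro sum.cong arg_cong[of _ _ card]) auto
    finally show ?thesis using U by (simp add: n_subsets)
  qed
  have "\<exists>f. inj_on f (?L A) \<and> (\<forall>S\<in>?L A. f S \<in> ?N S)"
  proof (rule hall_marriage)
    show "finite (?L A)" by (rule finL)
    show "finite (?N S)" for S using U by simp
    show "card F \<le> card (\<Union> (?N ` F))" if F: "F \<subseteq> ?L A" for F
    proof (cases "A = {}")
      case True
      then show ?thesis using F by simp
    next
      case False
      let ?G = "\<Union> (?N ` F)"
      let ?Fa = "\<lambda>a. {S\<in>F. card S = a}" and ?Gb = "\<lambda>b. {T\<in>?G. card T = b}"
      \<comment> \<open>For fixed \<open>b\<close>, the two-level inequalities are added over all
        \<open>a\<close>; the slices of \<open>F\<close> add up to \<open>F\<close> and the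
        binomials to \<open>?M\<close>.\<close>
      have level: "card F * (card U choose b) \<le> card (?Gb b) * ?M" if b: "b \<in> B" for b
      proof -
        have "card (?Fa a) * (card U choose b) \<le> card (?Gb b) * (card U choose a)"
          if a: "a \<in> A" for a
        proof -
          have "card (?Fa a) * (card U choose b)
              \<le> card {T. T \<subseteq> U \<and> card T = b \<and> (\<exists>S\<in>?Fa a. S \<subseteq> T \<or> T \<subseteq> S)} * (card U choose a)"
            using A B F a b by (intro levels_normalized_matching[OF U]) auto
          also have "\<dots> \<le> card (?Gb b) * (card U choose a)"
            using b U by (intro mult_le_mono1 card_mono) auto
          finally show ?thesis .
        qed
        then have "(\<Sum>a\<in>A. card (?Fa a) * (card U choose b))
            \<le> (\<Sum>a\<in>A. card (?Gb b) * (card U choose a))"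
          by (rule sum_mono)
        then show ?thesis
          using card_eq_sum_levels[OF U fin(1) F]
          by (simp add: sum_distrib_left sum_distrib_right)
      qed
      \<comment> \<open>Here \<open>eq\<close> enters: \<open>?M\<close> is also the total size of
        the levels in \<open>B\<close>.\<close>
      have "card F * ?M = (\<Sum>b\<in>B. card F * (card U choose b))"
        by (simp add: eq sum_distrib_left)
      also have "\<dots> \<le> (\<Sum>b\<in>B. card (?Gb b) * ?M)"
        using level by (rule sum_mono)
      also have "\<dots> = card ?G * ?M"
      proof -
        have "?G \<subseteq> ?L B" by blast
        from card_eq_sum_levels[OF U fin(2) this] show ?thesis
          by (simp only: sum_distrib_right)
      qed
      finally have "card F * ?M \<le> card ?G * ?M" .
      \<comment> \<open>Every term is positive since \<open>a \<le> card U\<close>, and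
        \<open>A\<close> is nonempty, so \<open>?M\<close> can be cancelled.\<close>
      moreover have "?M > 0" using False fin A by (intro sum_pos) auto
      ultimately show ?thesis by simp
    qed
  qed
  then obtain f where f: "inj_on f (?L A)" "\<And>S. S \<in> ?L A \<Longrightarrow> f S \<in> ?N S" by blast
  have "f ` ?L A \<subseteq> ?L B" using f(2) by blast
  moreover have "card (f ` ?L A) = card (?L B)"
    using card_image[OF f(1)] cardL fin eq by simp
  ultimately have "f ` ?L A = ?L B" by (simp add: card_subset_eq[OF finL])
  then have "bij_betw f (?L A) (?L B)" using f(1) by (simp add: bij_betw_def)
  then show ?thesis using f(2) by blast
qed

theorem theorem1p3:
  fixes n k m :: nat and a b :: "nat \<Rightarrow> nat"
  assumes "strict_mono_on {1..k} a" and "\<And>i. i \<in> {1..k} \<Longrightarrow> a i \<le> n"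
    and "strict_mono_on {1..m} b" and "\<And>j. j \<in> {1..m} \<Longrightarrow> b j \<le> n"
    and "\<And>i j. i \<in> {1..k} \<Longrightarrow> j \<in> {1..m} \<Longrightarrow> a i \<noteq> b j"
    and "(\<Sum>i = 1..k. n choose a i) = (\<Sum>j = 1..m. n choose b j)"
  shows "\<exists>\<Phi> :: nat set \<Rightarrow> nat set.
    bij_betw \<Phi> {S. S \<subseteq> {1..n} \<and> card S \<in> a ` {1..k}} {T. T \<subseteq> {1..n} \<and> card T \<in> b ` {1..m}} \<and>
    (\<forall>S \<in> {S. S \<subseteq> {1..n} \<and> card S \<in> a ` {1..k}}. S \<subseteq> \<Phi> S \<or> S \<supseteq> \<Phi> S)"
proof (rule binomial_identity_orderable)
  \<comment> \<open>Injectivity lets the sums over indices be reindexed as sums over the sets of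
    values.\<close>
  have "inj_on a {1..k}" "inj_on b {1..m}"
    using assms(1,3) by (simp_all add: strict_mono_on_imp_inj_on)
  then show "(\<Sum>x\<in>a ` {1..k}. card {1..n} choose x) = (\<Sum>x\<in>b ` {1..m}. card {1..n} choose x)"
    using assms(6) by (simp add: sum.reindex)
qed (use assms(2,4) in auto)

end
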